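(* Let $m,n,d\ge1$ be integers with $m>n$ and $m\ge n+d$. Let $A=A_0+A_1\mathbf{i}+A_2\mathbf{j}+A_3\mathbf{k}\in\mathbb{Q}_{\mathbb{R}}^{m\times n}$ and $B=B_0+B_1\mathbf{i}+B_2\mathbf{j}+B_3\mathbf{k}\in\mathbb{Q}_{\mathbb{R}}^{m\times d}$ (components real matrices), and put $C=[A_0^T,A_1^T,A_2^T,A_3^T]^T\in\mathbb{R}^{4m\times n}$, $D=[B_0^T,B_1^T,B_2^T,B_3^T]^T\in\mathbb{R}^{4m\times d}$. Let $Q\in\mathbb{R}^{4m\times4m}$ be an orthogonal matrix and write $Q^T[C,D]=[R_{22},R_{2d}]$ with $R_{22}\in\mathbb{R}^{4m\times n}$, $R_{2d}\in\mathbb{R}^{4m\times d}$. Let $[R_{22},R_{2d}]=U\Sigma V^T$ be a singular value decomposition with $U\in\mathbb{R}^{4m\times4m}$ and $V\in\mathbb{R}^{(n+d)\times(n+d)}$ orthogonal and singular values $$\sigma_1\ge\sigma_2\ge\cdots\ge\sigma_n\ge\sigma_{n+1}\ge\cdots\ge\sigma_{n+d}>0,$$ and partition $V=\begin{bmatrix} V_{11} & V_{12} \\ V_{21} & V_{22} \end{bmatrix}$ with $V_{11}\in\mathbb{R}^{n\times n}$, $V_{12}\in\mathbb{R}^{n\times d}$, $V_{21}\in\mathbb{R}^{d\times n}$, $V_{22}\in\mathbb{R}^{d\times d}$. If $\sigma_n>\sigma_{n+1}$ and $V_{22}$ is nonsingular, then the real RBTLS solution (for $A,B$) exists and is unique,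 and it is given by $$X=-V_{12}V_{22}^{-1}.$$
   Context: Reduced biquaternions: $\mathbb{Q}_{\mathbb{R}}$ is the commutative real algebra of elements $a=a_0+a_1\mathbf{i}+a_2\mathbf{j}+a_3\mathbf{k}$ ($a_t\in\mathbb{R}$) with $\mathbf{i}^2=\mathbf{k}^2=-1$, $\mathbf{j}^2=1$, $\mathbf{i}\mathbf{j}=\mathbf{j}\mathbf{i}=\mathbf{k}$, $\mathbf{j}\mathbf{k}=\mathbf{k}\mathbf{j}=\mathbf{i}$, $\mathbf{k}\mathbf{i}=\mathbf{i}\mathbf{k}=-\mathbf{j}$. The norm is $\|a\|=\sqrt{a_0^2+a_1^2+a_2^2+a_3^2}$, and for $M=(m_{ij})$ over $\mathbb{Q}_{\mathbb{R}}$, $\|M\|_F=\big(\sum_{i,j}\|m_{ij}\|^2\big)^{1/2}$. Real matrices are viewed as matrices over $\mathbb{Q}_{\mathbb{R}}$. RBTLS problem (unknown $X$ real): minimize $\|[\widehat E,\widehat G]\|_F$ over $X\in\mathbb{R}^{n\times d}$, $\widehat E\in\mathbb{Q}_{\mathbb{R}}^{m\times n}$, $\widehat G\in\mathbb{Q}_{\mathbb{R}}^{m\times d}$ subject to $(A+\widehat E)X=B+\widehat G$. A real RBTLS solution is a real $X$ for which there are $\widehat E,\widehat G$ such that $(X,\widehat E,\widehat G)$ is feasible and attains the minimum. *)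

theory Defs
  imports
    "HOL-Analysis.Product_Vector"
    "Jordan_Normal_Form.Matrix"
    "Jordan_Normal_Form.Gauss_Jordan_Elimination"
begin

section \<open>Reduced biquaternions\<close>

datatype rbquat = RBQuat (rb0: real) (rb1: real) (rb2: real) (rb3: real)

lemma rbquat_eq_iff:
  "a = b \<longleftrightarrow> rb0 a = rb0 b \<and> rb1 a = rb1 b \<and> rb2 a = rb2 b \<and> rb3 a = rb3 b"
  by (cases a; cases b) simp

instantiation rbquat :: comm_ring_1
begin

definition zero_rbquat :: rbquat where "0 = RBQuat 0 0 0 0"

definition one_rbquat :: rbquat where "1 = RBQuat 1 0 0 0"

definition plus_rbquat :: "rbquat \<Rightarrow> rbquat \<Rightarrow> rbquat" where
  "a + b = RBQuat (rb0 a + rb0 b) (rb1 a + rb1 b) (rb2 a + rb2 b) (rb3 a + rb3 b)"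

definition uminus_rbquat :: "rbquat \<Rightarrow> rbquat" where
  "- a = RBQuat (- rb0 a) (- rb1 a) (- rb2 a) (- rb3 a)"

definition minus_rbquat :: "rbquat \<Rightarrow> rbquat \<Rightarrow> rbquat" where
  "a - b = RBQuat (rb0 a - rb0 b) (rb1 a - rb1 b) (rb2 a - rb2 b) (rb3 a - rb3 b)"

text \<open>The bilinear extension of the multiplication table of the units, which is verified in
  \<open>rbquat_mult_table\<close> below.\<close>

definition times_rbquat :: "rbquat \<Rightarrow> rbquat \<Rightarrow> rbquat" where
  "a * b = RBQuat
     (rb0 a * rb0 b - rb1 a * rb1 b + rb2 a * rb2 b - rb3 a * rb3 b)
     (rb0 a * rb1 b + rb1 a * rb0 b + rb2 a * rb3 b + rb3 a * rb2 b)
     (rb0 a * rb2 b + rb2 a * rb0 b - rb1 a * rb3 b - rb3 a * rb1 b)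
     (rb0 a * rb3 b + rb3 a * rb0 b + rb1 a * rb2 b + rb2 a * rb1 b)"

instance
  by standard
    (simp_all add: rbquat_eq_iff zero_rbquat_def one_rbquat_def plus_rbquat_def
      uminus_rbquat_def minus_rbquat_def times_rbquat_def algebra_simps)

end

instantiation rbquat :: real_algebra_1
begin

definition scaleR_rbquat :: "real \<Rightarrow> rbquat \<Rightarrow> rbquat" where
  "scaleR r a = RBQuat (r * rb0 a) (r * rb1 a) (r * rb2 a) (r * rb3 a)"

instance
  by standard
    (simp_all add: rbquat_eq_iff plus_rbquat_def times_rbquat_def scaleR_rbquat_def algebra_simps)

end

instantiation rbquat :: real_normed_vector
begin

definition norm_rbquat_def:
  "norm (a::rbquat) = sqrt ((rb0 a)\<^sup>2 + (rb1 a)\<^sup>2 + (rb2 a)\<^sup>2 + (rb3 a)\<^sup>2)"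

definition sgn_rbquat_def:
  "sgn (a::rbquat) = scaleR (inverse (norm a)) a"

definition dist_rbquat_def:
  "dist (a::rbquat) b = norm (a - b)"

definition uniformity_rbquat_def:
  "(uniformity :: (rbquat \<times> rbquat) filter) = (INF e\<in>{0<..}. principal {(a, b). dist (a::rbquat) b < e})"

definition open_rbquat_def:
  "open (S::rbquat set) \<longleftrightarrow> (\<forall>x\<in>S. \<forall>\<^sub>F (x', y) in uniformity. x' = x \<longrightarrow> y \<in> S)"

instance
proof
  fix r :: real and a b :: rbquat and S :: "rbquat set"
  have norm_eq: "norm x = norm (Complex (rb0 x) (rb1 x), Complex (rb2 x) (rb3 x))" for x
    by (simp add: norm_rbquat_def norm_prod_def cmod_def add.assoc)
  show "dist a b = norm (a - b)" by (rule dist_rbquat_def)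
  show "sgn a = a /\<^sub>R norm a" by (rule sgn_rbquat_def)
  show "uniformity = (INF e\<in>{0<..}. principal {(a, b). dist (a::rbquat) b < e})"
    by (rule uniformity_rbquat_def)
  show "open S \<longleftrightarrow> (\<forall>x\<in>S. \<forall>\<^sub>F (x', y) in uniformity. x' = x \<longrightarrow> y \<in> S)"
    by (rule open_rbquat_def)
  show "norm a = 0 \<longleftrightarrow> a = 0"
    unfolding norm_eq by (simp add: rbquat_eq_iff zero_rbquat_def zero_prod_def complex_eq_iff)
  show "norm (a + b) \<le> norm a + norm b"
    unfolding norm_eq
    using norm_triangle_ineq[of "(Complex (rb0 a) (rb1 a), Complex (rb2 a) (rb3 a))"
        "(Complex (rb0 b) (rb1 b), Complex (rb2 b) (rb3 b))"]
    by (simp add: plus_rbquat_def plus_complex.ctr)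
  show "norm (r *\<^sub>R a) = \<bar>r\<bar> * norm a"
    unfolding norm_eq
    using norm_scaleR[of r "(Complex (rb0 a) (rb1 a), Complex (rb2 a) (rb3 a))"]
    by (simp add: scaleR_rbquat_def complex_scaleR)
qed

end

definition rb_i :: rbquat where "rb_i = RBQuat 0 1 0 0"
definition rb_j :: rbquat where "rb_j = RBQuat 0 0 1 0"
definition rb_k :: rbquat where "rb_k = RBQuat 0 0 0 1"

lemma rbquat_mult_table:
  "rb_i * rb_i = - 1" "rb_k * rb_k = - 1" "rb_j * rb_j = 1"
  "rb_i * rb_j = rb_k" "rb_j * rb_i = rb_k"
  "rb_j * rb_k = rb_i" "rb_k * rb_j = rb_i"
  "rb_k * rb_i = - rb_j" "rb_i * rb_k = - rb_j"
  by (simp_all add: rbquat_eq_iff rb_i_def rb_j_def rb_k_def one_rbquat_def uminus_rbquat_def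
      times_rbquat_def)

lemma of_real_rbquat: "of_real r = RBQuat r 0 0 0"
  by (simp add: of_real_def scaleR_rbquat_def one_rbquat_def)

lemma rbquat_decomp:
  "a = of_real (rb0 a) + of_real (rb1 a) * rb_i + of_real (rb2 a) * rb_j + of_real (rb3 a) * rb_k"
  by (simp add: rbquat_eq_iff of_real_rbquat rb_i_def rb_j_def rb_k_def plus_rbquat_def
      times_rbquat_def)


section \<open>Matrices\<close>

text \<open>The matrix \<open>[M, N]\<close>; it is meaningful when \<open>M\<close> and \<open>N\<close> have the same number of rows.\<close>

definition append_columns :: "'a::zero mat \<Rightarrow> 'a mat \<Rightarrow> 'a mat"  (infixr \<open>@\<^sub>c\<close> 65) where
  "M @\<^sub>c N = four_block_mat M N (0\<^sub>m 0 (dim_col M)) (0\<^sub>m 0 (dim_col N))"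

definition frobenius_norm :: "'a::real_normed_vector mat \<Rightarrow> real" where
  "frobenius_norm M = sqrt (\<Sum>i<dim_row M. \<Sum>j<dim_col M. (norm (M $$ (i, j)))\<^sup>2)"

definition component_stack :: "rbquat mat \<Rightarrow> real mat" where
  "component_stack M = map_mat rb0 M @\<^sub>r map_mat rb1 M @\<^sub>r map_mat rb2 M @\<^sub>r map_mat rb3 M"

text \<open>Orthogonality in the usual sense, with orthonormal columns. The constant \<open>orthogonal_mat\<close> of
  the library only asks for pairwise orthogonal nonzero columns.\<close>

definition real_orthogonal_mat :: "nat \<Rightarrow> real mat \<Rightarrow> bool" where
  "real_orthogonal_mat k Q \<longleftrightarrow>
     Q \<in> carrier_mat k k \<and> Q\<^sup>T * Q = 1\<^sub>m k \<and> Q * Q\<^sup>T = 1\<^sub>m k"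

text \<open>A full singular value decomposition of an \<open>r \<times> c\<close> matrix. Singular values are numbered
  from \<open>1\<close> to \<open>min r c\<close>, whereas matrix entries are indexed from \<open>0\<close>.\<close>

definition is_svd :: "real mat \<Rightarrow> real mat \<Rightarrow> (nat \<Rightarrow> real) \<Rightarrow> real mat \<Rightarrow> bool" where
  "is_svd M U \<sigma> V \<longleftrightarrow>
     real_orthogonal_mat (dim_row M) U \<and>
     real_orthogonal_mat (dim_col M) V \<and>
     (\<forall>i\<in>{1..min (dim_row M) (dim_col M)}. 0 \<le> \<sigma> i) \<and>
     (\<forall>i\<in>{1..<min (dim_row M) (dim_col M)}. \<sigma> (Suc i) \<le> \<sigma> i) \<and>
     M = U * mat (dim_row M) (dim_col M) (\<lambda>(i, j). if i = j then \<sigma> (Suc i) else 0) * V\<^sup>T"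


section \<open>The total least squares problem with a real unknown\<close>

definition rbtls_feasible ::
    "rbquat mat \<Rightarrow> rbquat mat \<Rightarrow> real mat \<Rightarrow> rbquat mat \<Rightarrow> rbquat mat \<Rightarrow> bool" where
  "rbtls_feasible A B X E G \<longleftrightarrow>
     X \<in> carrier_mat (dim_col A) (dim_col B) \<and>
     E \<in> carrier_mat (dim_row A) (dim_col A) \<and>
     G \<in> carrier_mat (dim_row B) (dim_col B) \<and>
     (A + E) * map_mat of_real X = B + G"

definition real_rbtls_solution :: "rbquat mat \<Rightarrow> rbquat mat \<Rightarrow> real mat \<Rightarrow> bool" where
  "real_rbtls_solution A B X \<longleftrightarrow>
     (\<exists>E G. rbtls_feasible A B X E G \<and>
       (\<forall>X' E' G'. rbtls_feasible A B X' E' G' \<longrightarrow>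
          frobenius_norm (E @\<^sub>c G) \<le> frobenius_norm (E' @\<^sub>c G')))"

end

theory Submission
  imports Defs "Jordan_Normal_Form.Determinant"
begin

text \<open>Stacking the four real components turns the problem into real total least squares for
  \<open>M = [C, D]\<close>: minimise \<open>\<parallel>W\<parallel>\<close> subject to \<open>(M + W) Z = 0\<close>, where \<open>Z = [X; -I]\<close>. For fixed \<open>X\<close>
  the minimum is \<open>\<parallel>M P\<parallel>\<close> with \<open>P\<close> the orthogonal projector onto the columns of \<open>Z\<close>, and
  \<open>\<parallel>M P\<parallel>\<^sup>2\<close> is the sum of \<open>\<sigma>\<^sub>i\<^sup>2 t\<^sub>i\<close>, where the diagonal \<open>t\<close> of \<open>V\<^sup>T P V\<close> has entries in \<open>[0, 1]\<close>
  and sum \<open>d\<close>. The gap at \<open>n\<close> forces the minimum to be attained exactly when \<open>t\<^sub>1 = \<dots> = t\<^sub>n = 0\<close>,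
  which says that \<open>Z\<close> lies in the span of the last \<open>d\<close> columns of \<open>V\<close> and so determines \<open>X\<close>.\<close>

section \<open>Matrix products, traces and Frobenius norms\<close>

text \<open>In this and the next three laws the side conditions compare dimensions only, with no
  free size variables, so that the simplifier can discharge them when rewriting.\<close>

lemma mult_mat_assoc_dim:
  assumes "dim_col A = dim_row B" "dim_col B = dim_row C"
  shows "(A * B) * C = A * (B * (C :: 'a::semiring_0 mat))"
  using assms by (intro assoc_mult_mat[of A "dim_row A" "dim_col A" B "dim_col B" C "dim_col C"]) auto

lemma mult_mat_diff_left_dim:
  assumes "dim_row A = dim_row B" "dim_col A = dim_col B" "dim_col B = dim_row C"
  shows "(A - B) * C = A * C - B * (C :: 'a::ring mat)"
  using assms by (intro minus_mult_distrib_mat[of A "dim_row A" "dim_col A" B C "dim_col C"]) auto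

lemma mult_mat_diff_right_dim:
  assumes "dim_row B = dim_row C" "dim_col B = dim_col C" "dim_col A = dim_row B"
  shows "A * (B - C) = A * B - A * (C :: 'a::ring mat)"
  using assms by (intro mult_minus_distrib_mat[of A "dim_row A" "dim_row B" B "dim_col B" C]) auto

lemma transpose_mult_dim:
  assumes "dim_col A = dim_row B"
  shows "(A * B)\<^sup>T = B\<^sup>T * (A :: 'a::comm_semiring_0 mat)\<^sup>T"
  using assms by (intro transpose_mult[of A "dim_row A" "dim_col A" B "dim_col B"]) auto

lemma index_mult_mat_sum:
  assumes "A \<in> carrier_mat r k" "B \<in> carrier_mat k c" "i < r" "j < c"
  shows "(A * B) $$ (i, j) = (\<Sum>l<k. A $$ (i, l) * B $$ (l, j))"
  using assms by (simp add: scalar_prod_def lessThan_atLeast0)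

definition mat_trace :: "'a::comm_monoid_add mat \<Rightarrow> 'a" where
  "mat_trace M = (\<Sum>i<dim_row M. M $$ (i, i))"

lemma mat_trace_mult_comm:
  fixes A B :: "'a::comm_semiring_0 mat"
  assumes A: "A \<in> carrier_mat r c" and B: "B \<in> carrier_mat c r"
  shows "mat_trace (A * B) = mat_trace (B * A)"
proof -
  have "mat_trace (A * B) = (\<Sum>i<r. \<Sum>l<c. A $$ (i, l) * B $$ (l, i))"
    unfolding mat_trace_def using A B
    by (auto simp: index_mult_mat_sum[OF A B] simp del: index_mult_mat(1) intro!: sum.cong)
  also have "\<dots> = (\<Sum>l<c. \<Sum>i<r. B $$ (l, i) * A $$ (i, l))"
    by (subst sum.swap) (simp add: mult.commute)
  also have "\<dots> = mat_trace (B * A)"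
    unfolding mat_trace_def using A B
    by (auto simp: index_mult_mat_sum[OF B A] simp del: index_mult_mat(1) intro!: sum.cong)
  finally show ?thesis .
qed

lemma mat_trace_minus:
  assumes "A \<in> carrier_mat k k" "B \<in> carrier_mat k k"
  shows "mat_trace (A - B) = mat_trace A - mat_trace (B :: 'a::ab_group_add mat)"
  using assms by (simp add: mat_trace_def sum_subtractf)

lemma frobenius_norm_sq:
  "(frobenius_norm M)\<^sup>2 = (\<Sum>i<dim_row M. \<Sum>j<dim_col M. (norm (M $$ (i, j)))\<^sup>2)"
  unfolding frobenius_norm_def by (intro real_sqrt_pow2 sum_nonneg) auto

lemma frobenius_norm_nonneg: "0 \<le> frobenius_norm M"
  unfolding frobenius_norm_def by (intro real_sqrt_ge_zero sum_nonneg) auto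

lemma frobenius_norm_sq_eq_trace:
  "(frobenius_norm (W :: real mat))\<^sup>2 = mat_trace (W * W\<^sup>T)"
  unfolding frobenius_norm_sq mat_trace_def
  by (auto simp: scalar_prod_def lessThan_atLeast0 power2_eq_square intro!: sum.cong)

lemma sum_lessThan_add_split:
  "(\<Sum>i<a + b. f i) = (\<Sum>i<a. f i) + (\<Sum>i<b. f (a + i) :: 'a::comm_monoid_add)"
  for a b :: nat
  by (induction b) (simp_all add: add.assoc)

lemma frobenius_norm_sq_append_columns:
  assumes "M \<in> carrier_mat r p" "N \<in> carrier_mat r q"
  shows "(frobenius_norm (M @\<^sub>c N))\<^sup>2 = (frobenius_norm M)\<^sup>2 + (frobenius_norm N)\<^sup>2"
  using assms unfolding frobenius_norm_sq append_columns_def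
  by (simp add: sum_lessThan_add_split sum.distrib)

text \<open>Symmetry and idempotence collapse W P P^T W^T to W P W^T, which makes the squared norm
  linear in \<open>P\<close>.\<close>

lemma frobenius_norm_sq_mult_projector:
  fixes W :: "real mat"
  assumes "P \<in> carrier_mat k k" "W \<in> carrier_mat r k" "P\<^sup>T = P" "P * P = P"
  shows "(frobenius_norm (W * P))\<^sup>2 = mat_trace (W * P * W\<^sup>T)"
proof -
  have "W * P * (W * P)\<^sup>T = W * ((P * P) * W\<^sup>T)"
    using assms(1-3) by (simp add: mult_mat_assoc_dim transpose_mult_dim)
  also have "\<dots> = W * P * W\<^sup>T"
    using assms by (simp add: mult_mat_assoc_dim)
  finally show ?thesis by (simp add: frobenius_norm_sq_eq_trace)
qed

text \<open>Pythagoras: the residual R = W - W P satisfies R R^T = W W^T - W P W^T, so the two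
  squared norms differ by the squared norm of R.\<close>

lemma frobenius_norm_sq_mult_projector_le:
  fixes W :: "real mat"
  assumes P: "P \<in> carrier_mat k k" "P\<^sup>T = P" "P * P = P" and W: "W \<in> carrier_mat r k"
  shows "(frobenius_norm (W * P))\<^sup>2 \<le> (frobenius_norm W)\<^sup>2"
proof -
  define R where "R = W - W * P"
  have PPW: "P * (P * W\<^sup>T) = P * W\<^sup>T"
    using P W by (simp flip: mult_mat_assoc_dim)
  have "R * R\<^sup>T = (W - W * P) * (W\<^sup>T - P * W\<^sup>T)"
    unfolding R_def using P W by (subst transpose_minus) (auto simp: transpose_mult_dim)
  also have "\<dots> = (W * W\<^sup>T - W * P * W\<^sup>T) - (W * P * W\<^sup>T - W * P * W\<^sup>T)"
    using P W PPW by (simp add: mult_mat_diff_left_dim mult_mat_diff_right_dim mult_mat_assoc_dim)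
  also have "\<dots> = W * W\<^sup>T - W * P * W\<^sup>T"
    using P W by (intro eq_matI) auto
  finally have "(frobenius_norm R)\<^sup>2 = mat_trace (W * W\<^sup>T) - mat_trace (W * P * W\<^sup>T)"
    using P W by (simp add: frobenius_norm_sq_eq_trace mat_trace_minus[of _ r])
  then show ?thesis
    using frobenius_norm_sq_mult_projector[OF P(1) W P(2,3)] zero_le_power2[of "frobenius_norm R"]
    by (simp add: frobenius_norm_sq_eq_trace)
qed

section \<open>Orthogonal projectors\<close>

text \<open>The left inverse \<open>L\<close> encodes full column rank. If Z^T Z v = 0, then Z v has
  length zero, and applying \<open>L\<close> to Z v = 0 gives v = 0.\<close>

lemma left_invertible_gram_inverse:
  fixes Z :: "real mat"
  assumes Z: "Z \<in> carrier_mat N d" and L: "L \<in> carrier_mat d N" "L * Z = 1\<^sub>m d"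
  obtains H where "H \<in> carrier_mat d d" "H * (Z\<^sup>T * Z) = 1\<^sub>m d" "(Z\<^sup>T * Z) * H = 1\<^sub>m d"
proof -
  let ?G = "Z\<^sup>T * Z"
  have G: "?G \<in> carrier_mat d d" using Z by auto
  have "v = 0\<^sub>v d" if v: "v \<in> carrier_vec d" and 0: "?G *\<^sub>v v = 0\<^sub>v d" for v
  proof -
    define w where "w = Z *\<^sub>v v"
    have w: "w \<in> carrier_vec N" unfolding w_def using Z v by auto
    have "w \<bullet> w = (Z\<^sup>T *\<^sub>v w) \<bullet> v"
      using transpose_vec_mult_scalar[OF Z v w] unfolding w_def by (rule sym)
    also have "Z\<^sup>T *\<^sub>v w = 0\<^sub>v d"
      unfolding w_def using Z v 0 assoc_mult_mat_vec[of "Z\<^sup>T" d N Z d v] by simp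
    finally have "w \<bullet> w = 0" using v by simp
    then have "w = 0\<^sub>v N"
      using w by (auto simp: scalar_prod_def sum_nonneg_eq_0_iff)
    then have "L *\<^sub>v w = 0\<^sub>v d" using L by auto
    moreover have "L *\<^sub>v w = v"
      unfolding w_def using L v assoc_mult_mat_vec[OF L(1) Z v] by simp
    ultimately show ?thesis by simp
  qed
  then have "det ?G \<noteq> 0"
    using det_0_iff_vec_prod_zero_field[OF G] by blast
  \<comment> \<open>\<open>undefined\<close> fills the extension slot of the ring record; being a
    unit does not depend on it.\<close>
  from det_non_zero_imp_unit[OF G this, of undefined]
  obtain H where "H \<in> carrier_mat d d" "H * ?G = 1\<^sub>m d" "?G * H = 1\<^sub>m d"
    by (auto simp: Units_def ring_mat_def)
  then show thesis using that by blast
qed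

text \<open>Transposing G H = 1 shows that H^T is a left inverse of \<open>G\<close>, and a left
  inverse agrees with a right inverse.\<close>

lemma symmetric_inverse:
  fixes G :: "'a::field mat"
  assumes G: "G \<in> carrier_mat d d" "G\<^sup>T = G" and H: "H \<in> carrier_mat d d" "H * G = 1\<^sub>m d" "G * H = 1\<^sub>m d"
  shows "H\<^sup>T = H"
proof -
  have "H\<^sup>T * G = 1\<^sub>m d" using G H(1,3) by (metis transpose_mult transpose_one)
  then have "H\<^sup>T * G * H = H" using H(1) by simp
  moreover have "H\<^sup>T * G * H = H\<^sup>T" using G H by (simp add: mult_mat_assoc_dim)
  ultimately show ?thesis by simp
qed

text \<open>\<open>K\<close> is the pseudoinverse (Z^T Z)^(-1) Z^T. Since K Z = 1, the symmetric
  matrix Z K is idempotent and fixes \<open>Z\<close>: it is the orthogonal projector onto the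
  columns of \<open>Z\<close>.\<close>

lemma column_space_projector:
  fixes Z :: "real mat"
  assumes Z: "Z \<in> carrier_mat N d" and L: "L \<in> carrier_mat d N" "L * Z = 1\<^sub>m d"
  obtains K where "K \<in> carrier_mat d N" "K * Z = 1\<^sub>m d" "(Z * K)\<^sup>T = Z * K"
proof -
  obtain H where H: "H \<in> carrier_mat d d" "H * (Z\<^sup>T * Z) = 1\<^sub>m d" "(Z\<^sup>T * Z) * H = 1\<^sub>m d"
    using left_invertible_gram_inverse[OF assms] .
  have "H\<^sup>T = H"
    using Z H by (intro symmetric_inverse[OF _ _ H]) (auto simp: transpose_mult_dim)
  show thesis
  proof (rule that)
    show "H * Z\<^sup>T \<in> carrier_mat d N" using Z H(1) by auto
    show "H * Z\<^sup>T * Z = 1\<^sub>m d" using Z H(1,2) by (simp add: mult_mat_assoc_dim)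
    show "(Z * (H * Z\<^sup>T))\<^sup>T = Z * (H * Z\<^sup>T)"
      using Z H(1) \<open>H\<^sup>T = H\<close> by (simp add: transpose_mult_dim mult_mat_assoc_dim)
  qed
qed

text \<open>Symmetry and T T = T make each diagonal entry the sum of the squares of its row. That
  sum contains the square of the entry itself, and it vanishes only if the whole row does.\<close>

lemma projector_diag:
  fixes T :: "real mat"
  assumes T: "T \<in> carrier_mat N N" "T\<^sup>T = T" "T * T = T" and i: "i < N"
  shows "0 \<le> T $$ (i, i)" "T $$ (i, i) \<le> 1"
    and "T $$ (i, i) = 0 \<Longrightarrow> j < N \<Longrightarrow> T $$ (i, j) = 0"
proof -
  have sym: "T $$ (l, k) = T $$ (k, l)" if "k < N" "l < N" for k l
    using T(1,2) that by (metis carrier_matD index_transpose_mat(1))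
  have eq: "T $$ (i, i) = (\<Sum>l<N. (T $$ (i, l))\<^sup>2)"
    using index_mult_mat_sum[OF T(1) T(1) i i] T(3) i sym
    by (simp add: power2_eq_square)
  show ge0: "0 \<le> T $$ (i, i)" unfolding eq by (intro sum_nonneg) auto
  have "(T $$ (i, i))\<^sup>2 \<le> T $$ (i, i)"
    using member_le_sum[of i "{..<N}" "\<lambda>l. (T $$ (i, l))\<^sup>2"] i eq by auto
  then show "T $$ (i, i) \<le> 1"
    using ge0 by (cases "T $$ (i, i) = 0") (auto simp: power2_eq_square)
  show "T $$ (i, i) = 0 \<Longrightarrow> j < N \<Longrightarrow> T $$ (i, j) = 0"
    using eq by (simp add: sum_nonneg_eq_0_iff)
qed

section \<open>Real total least squares\<close>

text \<open>Putting weight 1 on each of the last \<open>d\<close> indices gives the tail sum. Any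
  weight on the first \<open>n\<close> indices is missing from the tail, and each unit so moved
  raises the sum by at least a - b. Keeping this excess term yields the equality case as well as the
  bound.\<close>

lemma weighted_sum_ge_tail:
  fixes s t :: "nat \<Rightarrow> real"
  assumes t: "\<And>i. i < n + d \<Longrightarrow> 0 \<le> t i" "\<And>i. i < n + d \<Longrightarrow> t i \<le> 1"
    and total: "(\<Sum>i<n + d. t i) = real d"
    and s: "\<And>i. i < n \<Longrightarrow> a \<le> s i" "\<And>i. i < d \<Longrightarrow> s (n + i) \<le> b"
  shows "(\<Sum>i<d. s (n + i)) + (a - b) * (\<Sum>i<n. t i) \<le> (\<Sum>i<n + d. s i * t i)"
proof -
  have *: "(\<Sum>i<n. t i) = (\<Sum>i<d. 1 - t (n + i))"
    using total by (simp add: sum_lessThan_add_split sum_subtractf)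
  have "a * (\<Sum>i<n. t i) \<le> (\<Sum>i<n. s i * t i)"
    unfolding sum_distrib_left using t s by (intro sum_mono mult_right_mono) auto
  moreover have "(\<Sum>i<d. s (n + i) * (1 - t (n + i))) \<le> b * (\<Sum>i<d. 1 - t (n + i))"
    unfolding sum_distrib_left using t s by (intro sum_mono mult_right_mono) auto
  moreover have "(\<Sum>i<d. s (n + i) * (1 - t (n + i)))
      = (\<Sum>i<d. s (n + i)) - (\<Sum>i<d. s (n + i) * t (n + i))"
    by (simp add: right_diff_distrib sum_subtractf)
  moreover have "(\<Sum>i<n + d. s i * t i) = (\<Sum>i<n. s i * t i) + (\<Sum>i<d. s (n + i) * t (n + i))"
    by (rule sum_lessThan_add_split)
  moreover have "(a - b) * (\<Sum>i<n. t i) = a * (\<Sum>i<n. t i) - b * (\<Sum>i<d. 1 - t (n + i))"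
    by (simp add: left_diff_distrib *)
  ultimately show ?thesis by linarith
qed

text \<open>The weights are the diagonal of T = V^T P V with P = Z K, itself an orthogonal
  projector. Both the lower bound and its attainment rest on this description.\<close>

lemma projector_diag_weights:
  fixes M V Z K :: "real mat" and s :: "nat \<Rightarrow> real"
  assumes M: "M \<in> carrier_mat r N"
    and V: "V \<in> carrier_mat N N" "V\<^sup>T * V = 1\<^sub>m N" "V * V\<^sup>T = 1\<^sub>m N"
    and gram: "M\<^sup>T * M = V * mat N N (\<lambda>(i, j). if i = j then s i else 0) * V\<^sup>T"
    and Z: "Z \<in> carrier_mat N d"
    and K: "K \<in> carrier_mat d N" "K * Z = 1\<^sub>m d" "(Z * K)\<^sup>T = Z * K"
  obtains t :: "nat \<Rightarrow> real"
  where "\<And>i. i < N \<Longrightarrow> 0 \<le> t i" "\<And>i. i < N \<Longrightarrow> t i \<le> 1" "(\<Sum>i<N. t i) = real d"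
    and "(frobenius_norm (M * (Z * K)))\<^sup>2 = (\<Sum>i<N. s i * t i)"
    and "\<And>i. i < N \<Longrightarrow> t i = 0 \<longleftrightarrow> (\<forall>j<d. (V\<^sup>T * Z) $$ (i, j) = 0)"
proof -
  define P where "P = Z * K"
  define T where "T = V\<^sup>T * (P * V)"
  define \<Lambda> where "\<Lambda> = mat N N (\<lambda>(i, j). if i = j then s i else 0)"
  have \<Lambda>: "\<Lambda> \<in> carrier_mat N N" unfolding \<Lambda>_def by auto
  have P: "P \<in> carrier_mat N N" "P\<^sup>T = P" unfolding P_def using Z K by auto
  have KZ: "K * (Z * K) = K" using K Z by (simp flip: mult_mat_assoc_dim)
  have PP: "P * P = P" unfolding P_def using Z K KZ by (simp add: mult_mat_assoc_dim)
  have PZ: "P * Z = Z" unfolding P_def using Z K by (simp add: mult_mat_assoc_dim)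
  have VV: "V * (V\<^sup>T * X) = X" if "X \<in> carrier_mat N k" for X :: "real mat" and k
    using V that by (simp flip: mult_mat_assoc_dim)
  have T: "T \<in> carrier_mat N N" unfolding T_def using P V by auto
  have TT: "T\<^sup>T = T" unfolding T_def using P V by (simp add: transpose_mult_dim mult_mat_assoc_dim)
  have "T * T = V\<^sup>T * (P * (V * (V\<^sup>T * (P * V))))"
    unfolding T_def using P V by (simp add: mult_mat_assoc_dim)
  also have "\<dots> = V\<^sup>T * ((P * P) * V)"
    using P V by (simp add: VV[of _ N] mult_mat_assoc_dim)
  finally have T2: "T * T = T" by (simp add: PP T_def)
  \<comment> \<open>Cyclicity of the trace carries T to P = Z K and then to K Z, the identity of
    size \<open>d\<close>.\<close>
  have trace: "mat_trace T = real d"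
  proof -
    have "mat_trace T = mat_trace ((P * V) * V\<^sup>T)"
      unfolding T_def using P V by (intro mat_trace_mult_comm[of _ N N]) auto
    also have "(P * V) * V\<^sup>T = P" using P V by (simp add: mult_mat_assoc_dim)
    also have "mat_trace P = mat_trace (K * Z)"
      unfolding P_def using Z K by (intro mat_trace_mult_comm) auto
    finally show ?thesis by (simp add: K mat_trace_def)
  qed
  \<comment> \<open>Cyclicity brings the Gram matrix of \<open>M\<close> together; its
    diagonalization by \<open>V\<close> then turns the trace into that of
    \<open>\<Lambda> * T\<close>.\<close>
  have "(frobenius_norm (M * P))\<^sup>2 = mat_trace (M * P * M\<^sup>T)"
    by (rule frobenius_norm_sq_mult_projector[OF P(1) M P(2) PP])
  also have "\<dots> = mat_trace (M\<^sup>T * (M * P))"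
    using M P by (intro mat_trace_mult_comm[of _ r N]) auto
  also have "M\<^sup>T * (M * P) = (M\<^sup>T * M) * P"
    using M P by (simp add: mult_mat_assoc_dim)
  also have "\<dots> = V * (\<Lambda> * (V\<^sup>T * P))"
    unfolding gram \<Lambda>_def using P V by (simp add: mult_mat_assoc_dim)
  also have "mat_trace \<dots> = mat_trace ((\<Lambda> * (V\<^sup>T * P)) * V)"
    using V \<Lambda> P by (intro mat_trace_mult_comm[of _ N N]) auto
  also have "(\<Lambda> * (V\<^sup>T * P)) * V = \<Lambda> * T"
    unfolding T_def using V \<Lambda> P by (simp add: mult_mat_assoc_dim)
  also have "mat_trace (\<Lambda> * T) = (\<Sum>i<N. s i * T $$ (i, i))"
  proof -
    have "(\<Lambda> * T) $$ (i, i) = s i * T $$ (i, i)" if "i < N" for i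
    proof -
      have "(\<Lambda> * T) $$ (i, i) = (\<Sum>l<N. if l = i then s i * T $$ (l, i) else 0)"
        unfolding index_mult_mat_sum[OF \<Lambda> T that that]
        using that by (intro sum.cong) (auto simp: \<Lambda>_def)
      then show ?thesis using that by simp
    qed
    then show ?thesis using \<Lambda> by (simp add: mat_trace_def)
  qed
  finally have fro: "(frobenius_norm (M * (Z * K)))\<^sup>2 = (\<Sum>i<N. s i * T $$ (i, i))"
    by (simp add: P_def)
  have VZ: "V\<^sup>T * Z \<in> carrier_mat N d" using V Z by auto
  \<comment> \<open>\<open>T\<close> fixes V^T Z, so a zero row of \<open>T\<close> is a zero row of
    V^T Z. The factorization \<open>TZK\<close> gives the converse direction.\<close>
  have "T * (V\<^sup>T * Z) = V\<^sup>T * (P * (V * (V\<^sup>T * Z)))"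
    unfolding T_def using V P Z by (simp add: mult_mat_assoc_dim)
  then have TVZ: "T * (V\<^sup>T * Z) = V\<^sup>T * Z" by (simp add: VV[OF Z] PZ)
  have KV: "K * V \<in> carrier_mat d N" using K V by auto
  have TZK: "T = (V\<^sup>T * Z) * (K * V)"
    unfolding T_def P_def using V K Z by (simp add: mult_mat_assoc_dim)
  have zero: "T $$ (i, i) = 0 \<longleftrightarrow> (\<forall>j<d. (V\<^sup>T * Z) $$ (i, j) = 0)" if i: "i < N" for i
  proof
    assume "T $$ (i, i) = 0"
    then have "T $$ (i, l) = 0" if "l < N" for l
      using projector_diag(3)[OF T TT T2 i] that by blast
    then show "\<forall>j<d. (V\<^sup>T * Z) $$ (i, j) = 0"
      using index_mult_mat_sum[OF T VZ i] by (simp add: TVZ)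
  next
    assume "\<forall>j<d. (V\<^sup>T * Z) $$ (i, j) = 0"
    then show "T $$ (i, i) = 0"
      using index_mult_mat_sum[OF VZ KV i i] by (simp flip: TZK)
  qed
  show thesis
    using projector_diag(1,2)[OF T TT T2] trace fro zero T
    by (intro that[of "\<lambda>i. T $$ (i, i)"]) (auto simp: mat_trace_def)
qed

text \<open>The constraint says W Z = - M Z, hence W P = - M P for the projector P = Z K, and the
  norm of \<open>W\<close> is at least that of M P. In the equality case the positive factor a - b
  forces the first \<open>n\<close> weights to vanish, and with them the first \<open>n\<close> rows
  of V^T Z.\<close>

lemma total_least_squares_bound:
  fixes M V Z L W :: "real mat" and s :: "nat \<Rightarrow> real"
  assumes M: "M \<in> carrier_mat r (n + d)"
    and V: "V \<in> carrier_mat (n + d) (n + d)" "V\<^sup>T * V = 1\<^sub>m (n + d)" "V * V\<^sup>T = 1\<^sub>m (n + d)"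
    and gram: "M\<^sup>T * M = V * mat (n + d) (n + d) (\<lambda>(i, j). if i = j then s i else 0) * V\<^sup>T"
    and gap: "\<And>i. i < n \<Longrightarrow> a \<le> s i" "\<And>i. i < d \<Longrightarrow> s (n + i) \<le> b" "b < a"
    and Z: "Z \<in> carrier_mat (n + d) d" and L: "L \<in> carrier_mat d (n + d)" "L * Z = 1\<^sub>m d"
    and W: "W \<in> carrier_mat r (n + d)" "(M + W) * Z = 0\<^sub>m r d"
  shows "(\<Sum>i<d. s (n + i)) \<le> (frobenius_norm W)\<^sup>2"
    and "(frobenius_norm W)\<^sup>2 \<le> (\<Sum>i<d. s (n + i)) \<Longrightarrow> i < n \<Longrightarrow> j < d \<Longrightarrow> (V\<^sup>T * Z) $$ (i, j) = 0"
proof -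
  obtain K where K: "K \<in> carrier_mat d (n + d)" "K * Z = 1\<^sub>m d" "(Z * K)\<^sup>T = Z * K"
    using column_space_projector[OF Z L] .
  obtain t where t: "\<And>i. i < n + d \<Longrightarrow> 0 \<le> t i" "\<And>i. i < n + d \<Longrightarrow> t i \<le> 1"
      "(\<Sum>i<n + d. t i) = real d"
      "(frobenius_norm (M * (Z * K)))\<^sup>2 = (\<Sum>i<n + d. s i * t i)"
      "\<And>i. i < n + d \<Longrightarrow> t i = 0 \<longleftrightarrow> (\<forall>j<d. (V\<^sup>T * Z) $$ (i, j) = 0)"
    using projector_diag_weights[OF M V gram Z K] by blast
  have ZK: "Z * K \<in> carrier_mat (n + d) (n + d)" using Z K by auto
  have "M * Z + W * Z = 0\<^sub>m r d" using W add_mult_distrib_mat[OF M W(1) Z] by simp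
  then have *: "(M * Z) $$ (i, j) + (W * Z) $$ (i, j) = 0" if "i < r" "j < d" for i j
    using that M W Z by (metis index_add_mat(1) index_zero_mat(1) carrier_matD index_mult_mat(2,3))
  have "W * Z = - (M * Z)"
    using M W Z * by (intro eq_matI) (auto simp del: index_mult_mat(1) simp: eq_neg_iff_add_eq_0 add.commute)
  then have "W * Z * K = - (M * Z) * K" by simp
  also have "\<dots> = - (M * Z * K)" using M Z K by auto
  finally have "W * (Z * K) = - (M * (Z * K))"
    using M W Z K by (simp add: mult_mat_assoc_dim)
  then have "(frobenius_norm (W * (Z * K)))\<^sup>2 = (\<Sum>i<n + d. s i * t i)"
    using M ZK by (simp add: t(4)[symmetric] frobenius_norm_sq del: index_mult_mat(1))
  \<comment> \<open>The idempotence of \<open>Z * K\<close> is obtained by regrouping around the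
    inner product \<open>K * Z\<close>, which is the identity.\<close>
  moreover have "(frobenius_norm (W * (Z * K)))\<^sup>2 \<le> (frobenius_norm W)\<^sup>2"
    using Z K W
    by (intro frobenius_norm_sq_mult_projector_le[OF ZK K(3) _ W(1)])
      (simp add: mult_mat_assoc_dim flip: mult_mat_assoc_dim[of K Z])
  ultimately have le: "(\<Sum>i<d. s (n + i)) + (a - b) * (\<Sum>i<n. t i) \<le> (frobenius_norm W)\<^sup>2"
    using weighted_sum_ge_tail[where n = n and d = d and t = t and s = s and a = a and b = b] t(1,2,3) gap(1,2)
    by fastforce
  have tn: "0 \<le> (\<Sum>i<n. t i)" using t(1) by (intro sum_nonneg) auto
  then have "0 \<le> (a - b) * (\<Sum>i<n. t i)" using gap(3) by simp
  with le show "(\<Sum>i<d. s (n + i)) \<le> (frobenius_norm W)\<^sup>2" by linarith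
  assume "(frobenius_norm W)\<^sup>2 \<le> (\<Sum>i<d. s (n + i))" and ij: "i < n" "j < d"
  with le have "(a - b) * (\<Sum>i<n. t i) \<le> 0" by linarith
  with gap(3) tn have "(\<Sum>i<n. t i) = 0" by (simp add: mult_le_0_iff)
  with t(1) ij have "t i = 0" by (subst (asm) sum_nonneg_eq_0_iff) auto
  with t(5) ij show "(V\<^sup>T * Z) $$ (i, j) = 0" by simp
qed

text \<open>The correction W = - M P with P = Z K is feasible because P Z = Z, and its squared norm
  is the weighted sum.\<close>

lemma total_least_squares_attained:
  fixes M V Z L :: "real mat" and s :: "nat \<Rightarrow> real"
  assumes M: "M \<in> carrier_mat r (n + d)"
    and V: "V \<in> carrier_mat (n + d) (n + d)" "V\<^sup>T * V = 1\<^sub>m (n + d)" "V * V\<^sup>T = 1\<^sub>m (n + d)"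
    and gram: "M\<^sup>T * M = V * mat (n + d) (n + d) (\<lambda>(i, j). if i = j then s i else 0) * V\<^sup>T"
    and Z: "Z \<in> carrier_mat (n + d) d" and L: "L \<in> carrier_mat d (n + d)" "L * Z = 1\<^sub>m d"
    and zero: "\<And>i j. i < n \<Longrightarrow> j < d \<Longrightarrow> (V\<^sup>T * Z) $$ (i, j) = 0"
  obtains W where "W \<in> carrier_mat r (n + d)" "(M + W) * Z = 0\<^sub>m r d"
    "(frobenius_norm W)\<^sup>2 = (\<Sum>i<d. s (n + i))"
proof -
  obtain K where K: "K \<in> carrier_mat d (n + d)" "K * Z = 1\<^sub>m d" "(Z * K)\<^sup>T = Z * K"
    using column_space_projector[OF Z L] .
  obtain t where t: "\<And>i. i < n + d \<Longrightarrow> 0 \<le> t i" "\<And>i. i < n + d \<Longrightarrow> t i \<le> 1"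
      "(\<Sum>i<n + d. t i) = real d"
      "(frobenius_norm (M * (Z * K)))\<^sup>2 = (\<Sum>i<n + d. s i * t i)"
      "\<And>i. i < n + d \<Longrightarrow> t i = 0 \<longleftrightarrow> (\<forall>j<d. (V\<^sup>T * Z) $$ (i, j) = 0)"
    using projector_diag_weights[OF M V gram Z K] by blast
  have tn: "t i = 0" if "i < n" for i using t(5) zero that by simp
  \<comment> \<open>With the first \<open>n\<close> weights zero, the remaining \<open>d\<close>
    weights are at most 1 and sum to \<open>d\<close>, so each equals 1.\<close>
  have "(\<Sum>i<d. 1 - t (n + i)) = 0"
    using t(3) tn by (simp add: sum_lessThan_add_split sum_subtractf)
  then have td: "t (n + i) = 1" if "i < d" for i
    using t(2) that by (subst (asm) sum_nonneg_eq_0_iff) auto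
  define W where "W = - (M * (Z * K))"
  have W: "W \<in> carrier_mat r (n + d)" unfolding W_def using M Z K by auto
  have "W * Z = - (M * (Z * K) * Z)" unfolding W_def using M Z K by auto
  also have "M * (Z * K) * Z = M * Z" using M Z K by (simp add: mult_mat_assoc_dim)
  finally have "M * Z + W * Z = 0\<^sub>m r d" using M Z by (intro eq_matI) auto
  then have "(M + W) * Z = 0\<^sub>m r d" using add_mult_distrib_mat[OF M W Z] by simp
  moreover have "(frobenius_norm W)\<^sup>2 = (\<Sum>i<n + d. s i * t i)"
    unfolding W_def t(4)[symmetric] using M Z K by (simp add: frobenius_norm_sq del: index_mult_mat(1))
  then have "(frobenius_norm W)\<^sup>2 = (\<Sum>i<d. s (n + i))"
    by (simp add: sum_lessThan_add_split tn td)
  ultimately show thesis using that W by blast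
qed

section \<open>Block matrices and the homogeneous form of the constraint\<close>

lemma append_columns_carrier:
  "M \<in> carrier_mat r p \<Longrightarrow> N \<in> carrier_mat r q \<Longrightarrow> M @\<^sub>c N \<in> carrier_mat r (p + q)"
  unfolding append_columns_def by auto

lemma append_columns_add:
  fixes M N :: "real mat"
  assumes "M \<in> carrier_mat r p" "N \<in> carrier_mat r q" "M' \<in> carrier_mat r p" "N' \<in> carrier_mat r q"
  shows "(M @\<^sub>c N) + (M' @\<^sub>c N') = (M + M') @\<^sub>c (N + N')"
  using assms unfolding append_columns_def by (intro eq_matI) auto

text \<open>Both concatenations are block matrices padded with empty blocks, so in the block product
  only the upper left block is nonempty.\<close>

lemma append_columns_mult_append_rows:
  fixes M N :: "real mat"
  assumes M: "M \<in> carrier_mat r p" and N: "N \<in> carrier_mat r q"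
    and X: "X \<in> carrier_mat p c" and Y: "Y \<in> carrier_mat q c"
  shows "(M @\<^sub>c N) * (X @\<^sub>r Y) = M * X + N * Y"
proof -
  have "(M @\<^sub>c N) * (X @\<^sub>r Y) = four_block_mat (M * X + N * Y) (M * 0\<^sub>m p 0 + N * 0\<^sub>m q 0)
      (0\<^sub>m 0 p * X + 0\<^sub>m 0 q * Y) (0\<^sub>m 0 p * 0\<^sub>m p 0 + 0\<^sub>m 0 q * 0\<^sub>m q 0)"
    using M N X Y mult_four_block_mat[OF M N zero_carrier_mat zero_carrier_mat X zero_carrier_mat Y zero_carrier_mat]
    by (simp add: append_columns_def append_rows_def)
  also have "\<dots> = M * X + N * Y"
    using M N X Y by (intro eq_matI) (auto simp del: index_mult_mat(1))
  finally show ?thesis .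
qed

lemma append_columns_split:
  assumes "W \<in> carrier_mat r (p + q)"
  obtains M N where "M \<in> carrier_mat r p" "N \<in> carrier_mat r q" "W = M @\<^sub>c N"
proof
  let ?M = "mat r p (\<lambda>(i, j). W $$ (i, j))" and ?N = "mat r q (\<lambda>(i, j). W $$ (i, p + j))"
  show "?M \<in> carrier_mat r p" "?N \<in> carrier_mat r q" by auto
  show "W = ?M @\<^sub>c ?N"
    using assms by (intro eq_matI) (auto simp: append_columns_def)
qed

text \<open>Homogenization: [C + E, D + G] times [X; -I] is (C + E) X - (D + G).\<close>

lemma tls_constraint_iff:
  fixes C D E G X :: "real mat"
  assumes C: "C \<in> carrier_mat r n" and D: "D \<in> carrier_mat r d"
    and E: "E \<in> carrier_mat r n" and G: "G \<in> carrier_mat r d" and X: "X \<in> carrier_mat n d"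
  shows "(C + E) * X = D + G \<longleftrightarrow> ((C @\<^sub>c D) + (E @\<^sub>c G)) * (X @\<^sub>r - 1\<^sub>m d) = 0\<^sub>m r d"
proof -
  have "((C @\<^sub>c D) + (E @\<^sub>c G)) * (X @\<^sub>r - 1\<^sub>m d) = (C + E) * X + (D + G) * (- 1\<^sub>m d)"
    unfolding append_columns_add[OF C D E G] using C D E G X
    by (intro append_columns_mult_append_rows) auto
  also have "(D + G) * (- 1\<^sub>m d) = - (D + G)"
    using D G by auto
  also have "(C + E) * X + - (D + G) = 0\<^sub>m r d \<longleftrightarrow> (C + E) * X = D + G"
  proof
    assume 0: "(C + E) * X + - (D + G) = 0\<^sub>m r d"
    show "(C + E) * X = D + G"
    proof (rule eq_matI)
      fix i j assume "i < dim_row (D + G)" "j < dim_col (D + G)"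
      then have ij: "i < r" "j < d" using G by auto
      have "((C + E) * X + - (D + G)) $$ (i, j) = 0" using ij unfolding 0 by simp
      then show "((C + E) * X) $$ (i, j) = (D + G) $$ (i, j)"
        using C D E G X ij by (simp del: index_mult_mat(1))
    qed (use E G X in auto)
  next
    assume "(C + E) * X = D + G"
    then show "(C + E) * X + - (D + G) = 0\<^sub>m r d"
      using D G by (intro eq_matI) auto
  qed
  finally show ?thesis by blast
qed

text \<open>\<open>V\<^sup>T [X; -I]\<close> has vanishing upper block iff \<open>[X; -I]\<close> lies in the span of the last
  \<open>d\<close> columns of \<open>V\<close>, i.e. iff it equals \<open>[V12 Y; V22 Y]\<close> for some \<open>Y\<close>.\<close>

lemma orthogonal_to_leading_columns_iff:
  fixes V11 V12 V21 V22 X H :: "real mat"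
  assumes carr: "V11 \<in> carrier_mat n n" "V12 \<in> carrier_mat n d"
    "V21 \<in> carrier_mat d n" "V22 \<in> carrier_mat d d"
    and V: "V = four_block_mat V11 V12 V21 V22" "V\<^sup>T * V = 1\<^sub>m (n + d)" "V * V\<^sup>T = 1\<^sub>m (n + d)"
    and H: "H \<in> carrier_mat d d" "V22 * H = 1\<^sub>m d" "H * V22 = 1\<^sub>m d"
    and X: "X \<in> carrier_mat n d"
  shows "(\<forall>i<n. \<forall>j<d. (V\<^sup>T * (X @\<^sub>r - 1\<^sub>m d)) $$ (i, j) = 0) \<longleftrightarrow> X = - (V12 * H)"
proof -
  let ?Z = "X @\<^sub>r - 1\<^sub>m d"
  have Vc: "V \<in> carrier_mat (n + d) (n + d)" using carr V(1) by simp
  have Zc: "?Z \<in> carrier_mat (n + d) d" using X by auto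
  \<comment> \<open>A vanishing upper block selects the last \<open>d\<close> columns of
    \<open>V\<close>.\<close>
  have VZ: "V * (0\<^sub>m n d @\<^sub>r Y) = (V12 * Y) @\<^sub>r (V22 * Y)" if Y: "Y \<in> carrier_mat d d" for Y
  proof -
    have "V * (0\<^sub>m n d @\<^sub>r Y) = four_block_mat (V11 * 0\<^sub>m n d + V12 * Y) (V11 * 0\<^sub>m n 0 + V12 * 0\<^sub>m d 0)
       (V21 * 0\<^sub>m n d + V22 * Y) (V21 * 0\<^sub>m n 0 + V22 * 0\<^sub>m d 0)"
      using mult_four_block_mat[OF carr zero_carrier_mat zero_carrier_mat Y zero_carrier_mat] Y
      by (simp add: append_rows_def V(1))
    also have "\<dots> = (V12 * Y) @\<^sub>r (V22 * Y)"
      unfolding append_rows_def using carr Y by (intro cong_four_block_mat) auto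
    finally show ?thesis .
  qed
  have inj: "X = P \<and> - 1\<^sub>m d = R"
    if "?Z = P @\<^sub>r R" "P \<in> carrier_mat n d" "R \<in> carrier_mat d d" for P R :: "real mat"
  proof -
    have *: "?Z $$ (i, j) = (P @\<^sub>r R) $$ (i, j)" for i j using that(1) by simp
    have "X = P"
    proof (rule eq_matI)
      fix i j assume "i < dim_row P" "j < dim_col P"
      then show "X $$ (i, j) = P $$ (i, j)" using *[of i j] X that by (simp add: append_rows_def)
    qed (use X that in auto)
    moreover have "- 1\<^sub>m d = R"
    proof (rule eq_matI)
      fix i j assume "i < dim_row R" "j < dim_col R"
      then show "(- 1\<^sub>m d) $$ (i, j) = R $$ (i, j)"
        using *[of "n + i" j] X that by (simp add: append_rows_def)
    qed (use that in auto)
    ultimately show ?thesis ..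
  qed
  show ?thesis
  proof
    assume zero: "\<forall>i<n. \<forall>j<d. (V\<^sup>T * ?Z) $$ (i, j) = 0"
    \<comment> \<open>\<open>Y\<close> holds the coordinates of [X; -I] with respect to the last
      \<open>d\<close> columns of \<open>V\<close>.\<close>
    define Y where "Y = mat d d (\<lambda>(i, j). (V\<^sup>T * ?Z) $$ (n + i, j))"
    have Y: "Y \<in> carrier_mat d d" unfolding Y_def by auto
    have "V\<^sup>T * ?Z = 0\<^sub>m n d @\<^sub>r Y"
      using zero Vc Zc by (intro eq_matI) (auto simp: append_rows_def Y_def simp del: index_mult_mat(1))
    then have "V * (V\<^sup>T * ?Z) = V * (0\<^sub>m n d @\<^sub>r Y)" by simp
    moreover have "V * (V\<^sup>T * ?Z) = ?Z"
      using Vc Zc V(3) by (simp flip: mult_mat_assoc_dim)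
    ultimately have "?Z = (V12 * Y) @\<^sub>r (V22 * Y)" using VZ[OF Y] by simp
    from inj[OF this] have XY: "X = V12 * Y" "- 1\<^sub>m d = V22 * Y" using carr Y by auto
    \<comment> \<open>The lower block equation V22 Y = -I determines \<open>Y\<close>, and the upper
      block then determines \<open>X\<close>.\<close>
    have "Y = H * (V22 * Y)" using H carr(4) Y by (simp flip: mult_mat_assoc_dim)
    also have "\<dots> = - H" unfolding XY(2)[symmetric] using H(1) by auto
    finally show "X = - (V12 * H)" using XY(1) carr H(1) by auto
  next
    assume "X = - (V12 * H)"
    moreover have "V12 * (- H) = - (V12 * H)" "V22 * (- H) = - 1\<^sub>m d"
      using carr H by auto
    ultimately have "?Z = V * (0\<^sub>m n d @\<^sub>r - H)" using VZ[of "- H"] H(1) by simp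
    moreover have "V\<^sup>T * (V * N) = N" if "N \<in> carrier_mat (n + d) d" for N
      using Vc V(2) that by (simp flip: mult_mat_assoc_dim)
    moreover have "0\<^sub>m n d @\<^sub>r - H \<in> carrier_mat (n + d) d"
      using H(1) by auto
    ultimately have "V\<^sup>T * ?Z = 0\<^sub>m n d @\<^sub>r - H" by simp
    then show "\<forall>i<n. \<forall>j<d. (V\<^sup>T * ?Z) $$ (i, j) = 0"
      using H(1) by (simp add: append_rows_def)
  qed
qed

section \<open>Gram matrices and the singular value decomposition\<close>

text \<open>The least squares argument sees its data only through the Gram matrix, and there
  \<open>Q\<close> cancels. Hence a decomposition of Q^T [C, D] serves for [C, D] itself.\<close>

lemma orthogonal_factor_gram:
  fixes M :: "real mat"
  assumes Q: "real_orthogonal_mat r Q" and M: "M \<in> carrier_mat r c"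
  shows "(Q\<^sup>T * M)\<^sup>T * (Q\<^sup>T * M) = M\<^sup>T * M"
proof -
  have Qc: "Q \<in> carrier_mat r r" and QQ: "Q * Q\<^sup>T = 1\<^sub>m r"
    using Q by (auto simp: real_orthogonal_mat_def)
  have "(Q\<^sup>T * M)\<^sup>T * (Q\<^sup>T * M) = M\<^sup>T * ((Q * Q\<^sup>T) * M)"
    using Qc M by (simp add: transpose_mult_dim mult_mat_assoc_dim)
  then show ?thesis using QQ M by simp
qed

text \<open>The factor \<open>U\<close> cancels, leaving V S^T S V^T with a square diagonal middle
  factor.\<close>

lemma svd_gram:
  fixes M :: "real mat"
  assumes svd: "is_svd M U \<sigma> V" and M: "M \<in> carrier_mat r c" and "c \<le> r"
  shows "M\<^sup>T * M = V * mat c c (\<lambda>(i, j). if i = j then (\<sigma> (Suc i))\<^sup>2 else 0) * V\<^sup>T"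
proof -
  define S where "S = mat r c (\<lambda>(i, j). if i = j then \<sigma> (Suc i) else 0)"
  have S: "S \<in> carrier_mat r c" unfolding S_def by auto
  have U: "real_orthogonal_mat r U" and V: "real_orthogonal_mat c V" and eq: "M = U * S * V\<^sup>T"
    using svd M by (auto simp: is_svd_def S_def)
  have Uc: "U \<in> carrier_mat r r" and UU: "U\<^sup>T * U = 1\<^sub>m r" and Vc: "V \<in> carrier_mat c c"
    using U V by (auto simp: real_orthogonal_mat_def)
  have "M\<^sup>T * M = V * (S\<^sup>T * ((U\<^sup>T * U) * (S * V\<^sup>T)))"
    using Uc Vc S unfolding eq by (simp add: transpose_mult_dim mult_mat_assoc_dim)
  also have "\<dots> = V * (S\<^sup>T * S) * V\<^sup>T"
    using UU Vc S by (simp add: mult_mat_assoc_dim)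
  also have "S\<^sup>T * S = mat c c (\<lambda>(i, j). if i = j then (\<sigma> (Suc i))\<^sup>2 else 0)"
  proof (rule eq_matI)
    fix i j assume "i < dim_row (mat c c (\<lambda>(i, j). if i = j then (\<sigma> (Suc i))\<^sup>2 else 0))"
      and "j < dim_col (mat c c (\<lambda>(i, j). if i = j then (\<sigma> (Suc i))\<^sup>2 else 0))"
    then have ij: "i < c" "j < c" by auto
    have "(S\<^sup>T * S) $$ (i, j) = (\<Sum>l<r. S\<^sup>T $$ (i, l) * S $$ (l, j))"
      using S ij by (intro index_mult_mat_sum[of _ c r _ c]) auto
    also have "\<dots> = (\<Sum>l<r. if l = i then (if i = j then (\<sigma> (Suc i))\<^sup>2 else 0) else 0)"
      using ij by (intro sum.cong) (auto simp: S_def power2_eq_square)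
    \<comment> \<open>By \<open>c \<le> r\<close> the only contributing index, l = i, lies in the
      range of summation.\<close>
    also have "\<dots> = (if i = j then (\<sigma> (Suc i))\<^sup>2 else 0)"
      using ij \<open>c \<le> r\<close> by simp
    finally show "(S\<^sup>T * S) $$ (i, j) = mat c c (\<lambda>(i, j). if i = j then (\<sigma> (Suc i))\<^sup>2 else 0) $$ (i, j)"
      using ij by simp
  qed (use S in auto)
  finally show ?thesis .
qed

section \<open>Reduction of the biquaternion problem\<close>

lemma component_stack_carrier:
  "M \<in> carrier_mat m c \<Longrightarrow> component_stack M \<in> carrier_mat (4 * m) c"
  unfolding component_stack_def append_rows_def by auto

text \<open>The nested offsets match the repeated splitting of a sum over m + (m + (m + m)), used
  below for the Frobenius norm.\<close>

lemma component_stack_index: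
  assumes "M \<in> carrier_mat m c" "i < m" "j < c"
  shows "component_stack M $$ (i, j) = rb0 (M $$ (i, j))"
    "component_stack M $$ (m + i, j) = rb1 (M $$ (i, j))"
    "component_stack M $$ (m + (m + i), j) = rb2 (M $$ (i, j))"
    "component_stack M $$ (m + (m + (m + i)), j) = rb3 (M $$ (i, j))"
  using assms unfolding component_stack_def append_rows_def by auto

lemma less_4_mult_cases:
  fixes i m :: nat
  assumes "i < 4 * m"
  obtains k where "k < m" "i = k \<or> i = m + k \<or> i = m + (m + k) \<or> i = m + (m + (m + k))"
proof -
  consider "i < m" | "m \<le> i" "i < 2 * m" | "2 * m \<le> i" "i < 3 * m" | "3 * m \<le> i" by linarith
  then show thesis
  proof cases
    case 1 then show ?thesis using that[of i] by simp
  next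
    case 2 then show ?thesis using that[of "i - m"] by simp
  next
    case 3 then show ?thesis using that[of "i - 2 * m"] by simp
  next
    case 4 then show ?thesis using that[of "i - 3 * m"] assms by simp
  qed
qed

lemma component_stack_eqI:
  assumes M: "M \<in> carrier_mat m c" and W: "W \<in> carrier_mat (4 * m) c"
    and eq: "\<And>i j. i < m \<Longrightarrow> j < c \<Longrightarrow> W $$ (i, j) = rb0 (M $$ (i, j))"
      "\<And>i j. i < m \<Longrightarrow> j < c \<Longrightarrow> W $$ (m + i, j) = rb1 (M $$ (i, j))"
      "\<And>i j. i < m \<Longrightarrow> j < c \<Longrightarrow> W $$ (m + (m + i), j) = rb2 (M $$ (i, j))"
      "\<And>i j. i < m \<Longrightarrow> j < c \<Longrightarrow> W $$ (m + (m + (m + i)), j) = rb3 (M $$ (i, j))"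
  shows "component_stack M = W"
proof (rule eq_matI)
  fix i j assume "i < dim_row W" "j < dim_col W"
  then have i: "i < 4 * m" and j: "j < c" using W by auto
  obtain k where k: "k < m" "i = k \<or> i = m + k \<or> i = m + (m + k) \<or> i = m + (m + (m + k))"
    using less_4_mult_cases[OF i] .
  show "component_stack M $$ (i, j) = W $$ (i, j)"
    using k(2) component_stack_index[OF M k(1) j] eq[OF k(1) j] by auto
qed (use component_stack_carrier[OF M] W in auto)

lemma component_stack_inject:
  assumes M: "M \<in> carrier_mat m c" and N: "N \<in> carrier_mat m c"
  shows "component_stack M = component_stack N \<longleftrightarrow> M = N"
proof
  assume eq: "component_stack M = component_stack N"
  show "M = N"
  proof (rule eq_matI)
    fix i j assume "i < dim_row N" "j < dim_col N"
    then have ij: "i < m" "j < c" using N by auto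
    show "M $$ (i, j) = N $$ (i, j)"
      using component_stack_index[OF M ij] component_stack_index[OF N ij] eq
      by (simp add: rbquat_eq_iff)
  qed (use M N in auto)
qed simp

text \<open>Every real correction of the stacked data comes from a reduced biquaternion one, which
  lets a real minimizer be carried back.\<close>

lemma component_stack_surj:
  assumes W: "W \<in> carrier_mat (4 * m) c"
  obtains M where "M \<in> carrier_mat m c" "component_stack M = W"
proof
  let ?M = "mat m c (\<lambda>(i, j). RBQuat (W $$ (i, j)) (W $$ (m + i, j)) (W $$ (m + (m + i), j))
      (W $$ (m + (m + (m + i)), j)))"
  show "?M \<in> carrier_mat m c" by auto
  then show "component_stack ?M = W" using W by (intro component_stack_eqI) auto
qed

lemma component_stack_add:
  assumes M: "M \<in> carrier_mat m c" and N: "N \<in> carrier_mat m c"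
  shows "component_stack (M + N) = component_stack M + component_stack N"
  using M N component_stack_carrier[OF M] component_stack_carrier[OF N]
  by (intro component_stack_eqI) (auto simp: component_stack_index plus_rbquat_def)

lemma rb_sum:
  "rb0 (sum f A) = (\<Sum>x\<in>A. rb0 (f x))" "rb1 (sum f A) = (\<Sum>x\<in>A. rb1 (f x))"
  "rb2 (sum f A) = (\<Sum>x\<in>A. rb2 (f x))" "rb3 (sum f A) = (\<Sum>x\<in>A. rb3 (f x))"
  by (induction A rule: infinite_finite_induct) (auto simp: zero_rbquat_def plus_rbquat_def)

text \<open>Real scalars act on each of the four components separately. This is where the realness
  of the unknown enters: a general biquaternion factor would mix the components.\<close>

lemma component_stack_mult_of_real:
  assumes M: "M \<in> carrier_mat m n" and X: "X \<in> carrier_mat n d"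
  shows "component_stack (M * map_mat of_real X) = component_stack M * X"
proof (rule component_stack_eqI)
  note S = component_stack_carrier[OF M]
  show "M * map_mat of_real X \<in> carrier_mat m d" "component_stack M * X \<in> carrier_mat (4 * m) d"
    using M X S by auto
  fix i j assume ij: "i < m" "j < d"
  have R: "map_mat of_real X \<in> carrier_mat n d" using X by auto
  have *: "(M * map_mat of_real X) $$ (i, j) = (\<Sum>l<n. M $$ (i, l) * of_real (X $$ (l, j)))"
    using X ij by (subst index_mult_mat_sum[OF M R]) auto
  note rw = index_mult_mat_sum[OF S X _ ij(2)] * rb_sum component_stack_index[OF M ij(1)]
    of_real_rbquat times_rbquat_def
  show "(component_stack M * X) $$ (i, j) = rb0 ((M * map_mat of_real X) $$ (i, j))"
    "(component_stack M * X) $$ (m + i, j) = rb1 ((M * map_mat of_real X) $$ (i, j))"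
    "(component_stack M * X) $$ (m + (m + i), j) = rb2 ((M * map_mat of_real X) $$ (i, j))"
    "(component_stack M * X) $$ (m + (m + (m + i)), j) = rb3 ((M * map_mat of_real X) $$ (i, j))"
    using ij(1) by (simp_all add: rw del: index_mult_mat(1))
qed

text \<open>The norm of a reduced biquaternion is the Euclidean norm of its four components, which
  are merely redistributed over the row blocks.\<close>

lemma frobenius_norm_component_stack:
  assumes M: "M \<in> carrier_mat m c"
  shows "(frobenius_norm (component_stack M))\<^sup>2 = (frobenius_norm M)\<^sup>2"
proof -
  have 4: "4 * m = m + (m + (m + m))" by simp
  have "(frobenius_norm (component_stack M))\<^sup>2
      = (\<Sum>i<4 * m. \<Sum>j<c. (norm (component_stack M $$ (i, j)))\<^sup>2)"
    using component_stack_carrier[OF M] by (simp add: frobenius_norm_sq)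
  also have "\<dots> = (\<Sum>i<m. \<Sum>j<c. (norm (M $$ (i, j)))\<^sup>2)"
    unfolding 4 sum_lessThan_add_split sum.distrib[symmetric]
    by (intro sum.cong) (auto simp: component_stack_index[OF M] norm_rbquat_def)
  finally show ?thesis using M by (simp add: frobenius_norm_sq)
qed

text \<open>Stacking is injective, additive and compatible with right multiplication by a real
  matrix, so the constraint is equivalent to its stacked form, which is then homogenized.\<close>

lemma rbtls_feasible_iff:
  assumes A: "A \<in> carrier_mat m n" and B: "B \<in> carrier_mat m d"
  shows "rbtls_feasible A B X E G \<longleftrightarrow>
    X \<in> carrier_mat n d \<and> E \<in> carrier_mat m n \<and> G \<in> carrier_mat m d \<and>
    ((component_stack A @\<^sub>c component_stack B) + (component_stack E @\<^sub>c component_stack G))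
      * (X @\<^sub>r - 1\<^sub>m d) = 0\<^sub>m (4 * m) d"
proof (cases "X \<in> carrier_mat n d \<and> E \<in> carrier_mat m n \<and> G \<in> carrier_mat m d")
  case True
  then have X: "X \<in> carrier_mat n d" and E: "E \<in> carrier_mat m n" and G: "G \<in> carrier_mat m d"
    by auto
  have c: "(A + E) * map_mat of_real X \<in> carrier_mat m d" "B + G \<in> carrier_mat m d" "A + E \<in> carrier_mat m n"
    using X G mult_carrier_mat[OF add_carrier_mat[OF E, of A], of "map_mat of_real X" d] E by auto
  have "(A + E) * map_mat of_real X = B + G \<longleftrightarrow>
      (component_stack A + component_stack E) * X = component_stack B + component_stack G"
    unfolding component_stack_add[OF A E, symmetric] component_stack_add[OF B G, symmetric]
      component_stack_mult_of_real[OF c(3) X, symmetric] component_stack_inject[OF c(1,2)] ..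
  also have "\<dots> \<longleftrightarrow>
      ((component_stack A @\<^sub>c component_stack B) + (component_stack E @\<^sub>c component_stack G))
        * (X @\<^sub>r - 1\<^sub>m d) = 0\<^sub>m (4 * m) d"
    by (intro tls_constraint_iff[of _ _ n] component_stack_carrier A B E G X)
  finally show ?thesis using A B True by (simp add: rbtls_feasible_def)
qed (use A B in \<open>auto simp: rbtls_feasible_def\<close>)

lemma frobenius_norm_append_component_stack:
  assumes E: "E \<in> carrier_mat m n" and G: "G \<in> carrier_mat m d"
  shows "frobenius_norm (component_stack E @\<^sub>c component_stack G) = frobenius_norm (E @\<^sub>c G)"
proof -
  have "(frobenius_norm (component_stack E @\<^sub>c component_stack G))\<^sup>2 = (frobenius_norm (E @\<^sub>c G))\<^sup>2"
    using frobenius_norm_sq_append_columns[OF E G]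
      frobenius_norm_sq_append_columns[OF component_stack_carrier[OF E] component_stack_carrier[OF G]]
    by (simp add: frobenius_norm_component_stack[OF E] frobenius_norm_component_stack[OF G])
  then show ?thesis by (simp add: frobenius_norm_nonneg)
qed

section \<open>Ordering of singular values and the inverse of a nonsingular matrix\<close>

lemma svd_antimono:
  assumes "is_svd M U \<sigma> V" "1 \<le> i" "i \<le> j" "j \<le> min (dim_row M) (dim_col M)"
  shows "\<sigma> j \<le> \<sigma> i"
  using assms(3,4)
proof (induction j rule: dec_induct)
  case (step k)
  then have "\<sigma> (Suc k) \<le> \<sigma> k" using assms(1,2) by (auto simp: is_svd_def)
  with step show ?case by simp
qed simp

text \<open>Invertibility makes \<open>A\<close> a unit of the matrix ring, so
  \<open>mat_inverse A\<close> is not \<open>None\<close> and \<open>the\<close> yields the genuine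
  inverse.\<close>

lemma invertible_mat_inverse:
  fixes A :: "'a::field mat"
  assumes A: "A \<in> carrier_mat d d" and inv: "invertible_mat A"
  shows "the (mat_inverse A) \<in> carrier_mat d d" "A * the (mat_inverse A) = 1\<^sub>m d"
    "the (mat_inverse A) * A = 1\<^sub>m d"
proof -
  obtain B where B: "A * B = 1\<^sub>m d" "B * A = 1\<^sub>m (dim_row B)"
    using A inv by (auto simp: invertible_mat_def inverts_mat_def)
  \<comment> \<open>The size of \<open>B\<close> is read off from the column counts of the two
    product equations.\<close>
  have Bc: "B \<in> carrier_mat d d"
    using A B[THEN arg_cong[of _ _ dim_col]] by auto
  with A B have "A \<in> Units (ring_mat TYPE('a) d ())"
    by (auto simp: Units_def ring_mat_def intro!: bexI[of _ B])
  then obtain H where "mat_inverse A = Some H"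
    using mat_inverse(1)[OF A, of "()"] by (cases "mat_inverse A") auto
  with mat_inverse(2)[OF A this]
  show "the (mat_inverse A) \<in> carrier_mat d d" "A * the (mat_inverse A) = 1\<^sub>m d"
    "the (mat_inverse A) * A = 1\<^sub>m d" by auto
qed

theorem corollary3p6:
  fixes m n d :: nat
    and A B :: "rbquat mat"
    and C D Q R22 R2d U V V11 V12 V21 V22 :: "real mat"
    and \<sigma> :: "nat \<Rightarrow> real"
  assumes "m \<ge> 1" and "n \<ge> 1" and "d \<ge> 1" and "m > n" and "m \<ge> n + d"
    and "A \<in> carrier_mat m n" and "B \<in> carrier_mat m d"
    and "C = component_stack A" and "D = component_stack B"
    and "real_orthogonal_mat (4 * m) Q"
    and "R22 \<in> carrier_mat (4 * m) n" and "R2d \<in> carrier_mat (4 * m) d"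
    and "Q\<^sup>T * (C @\<^sub>c D) = R22 @\<^sub>c R2d"
    and "is_svd (R22 @\<^sub>c R2d) U \<sigma> V"
    and "\<sigma> (n + d) > 0"
    and "V11 \<in> carrier_mat n n" and "V12 \<in> carrier_mat n d"
    and "V21 \<in> carrier_mat d n" and "V22 \<in> carrier_mat d d"
    and "V = four_block_mat V11 V12 V21 V22"
    and "\<sigma> n > \<sigma> (n + 1)"
    and "invertible_mat V22"
  shows "(\<exists>!X. real_rbtls_solution A B X) \<and>
         real_rbtls_solution A B (- (V12 * the (mat_inverse V22)))"
proof -
  note A = assms(6) and B = assms(7) and svd = assms(14) and Vb = assms(16-19)
  note H = invertible_mat_inverse[OF assms(19,22)]
  let ?X = "- (V12 * the (mat_inverse V22))"
  define M where "M = component_stack A @\<^sub>c component_stack B"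
  \<comment> \<open>Index shift: singular values are numbered from 1, diagonal positions from
    0.\<close>
  define s where "s i = (\<sigma> (Suc i))\<^sup>2" for i
  \<comment> \<open>The sum of the squares of the \<open>d\<close> smallest singular values, to be
    shown the squared minimum.\<close>
  define opt where "opt = (\<Sum>i<d. s (n + i))"
  have M: "M \<in> carrier_mat (4 * m) (n + d)"
    unfolding M_def using A B by (intro append_columns_carrier component_stack_carrier)
  have R: "R22 @\<^sub>c R2d \<in> carrier_mat (4 * m) (n + d)"
    using assms(11,12) by (rule append_columns_carrier)
  have V: "V \<in> carrier_mat (n + d) (n + d)" "V\<^sup>T * V = 1\<^sub>m (n + d)" "V * V\<^sup>T = 1\<^sub>m (n + d)"
    using svd R by (auto simp: is_svd_def real_orthogonal_mat_def)
  have "M\<^sup>T * M = (R22 @\<^sub>c R2d)\<^sup>T * (R22 @\<^sub>c R2d)"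
    using orthogonal_factor_gram[OF assms(10) M] assms(8,9,13) by (simp add: M_def)
  also have "\<dots> = V * mat (n + d) (n + d) (\<lambda>(i, j). if i = j then s i else 0) * V\<^sup>T"
    unfolding s_def using assms(5) by (intro svd_gram[OF svd R]) simp
  finally have gram: "M\<^sup>T * M = \<dots>" .
  have nonneg: "0 \<le> \<sigma> i" if "1 \<le> i" "i \<le> n + d" for i
    using svd R that assms(5) by (auto simp: is_svd_def)
  have anti: "\<sigma> j \<le> \<sigma> i" if "1 \<le> i" "i \<le> j" "j \<le> n + d" for i j
    using svd_antimono[OF svd that(1,2)] R that(3) assms(5) by auto
  have gap: "(\<sigma> n)\<^sup>2 \<le> s i" if "i < n" for i
    unfolding s_def using that assms(2) by (intro power_mono anti nonneg) auto
  have gap': "s (n + i) \<le> (\<sigma> (n + 1))\<^sup>2" if "i < d" for i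
    unfolding s_def using that by (intro power_mono anti nonneg) auto
  \<comment> \<open>Squaring keeps the gap strict because \<sigma> at n + 1 is nonnegative;
    \<open>d \<ge> 1\<close> puts that index in range.\<close>
  have gap'': "(\<sigma> (n + 1))\<^sup>2 < (\<sigma> n)\<^sup>2"
    using assms(3,21) nonneg[of "n + 1"] by (intro power_strict_mono) auto
  \<comment> \<open>[0, -I] is a left inverse of [X; -I] for every \<open>X\<close>, so full column
    rank is automatic.\<close>
  define L where "L = 0\<^sub>m d n @\<^sub>c (- 1\<^sub>m d :: real mat)"
  have Lc: "L \<in> carrier_mat d (n + d)" unfolding L_def by (intro append_columns_carrier) auto
  have Zc: "X @\<^sub>r - 1\<^sub>m d \<in> carrier_mat (n + d) d" and LZ: "L * (X @\<^sub>r - 1\<^sub>m d) = 1\<^sub>m d"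
    if X: "X \<in> carrier_mat n d" for X :: "real mat"
  proof -
    show "X @\<^sub>r - 1\<^sub>m d \<in> carrier_mat (n + d) d" using X by auto
    have "L * (X @\<^sub>r - 1\<^sub>m d) = 0\<^sub>m d n * X + (- 1\<^sub>m d) * (- 1\<^sub>m d)"
      unfolding L_def using X by (intro append_columns_mult_append_rows) auto
    also have "\<dots> = 1\<^sub>m d" using X by auto
    finally show "L * (X @\<^sub>r - 1\<^sub>m d) = 1\<^sub>m d" .
  qed
  have X: "?X \<in> carrier_mat n d" using assms(17) H(1) by auto
  \<comment> \<open>Any feasible triple costs at least \<open>opt\<close>; cost \<open>opt\<close>
    places [X'; -I] in the span of the last \<open>d\<close> columns of \<open>V\<close>, which
    fixes X'.\<close>
  have bound: "opt \<le> (frobenius_norm (E @\<^sub>c G))\<^sup>2"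
    and bound_strict: "(frobenius_norm (E @\<^sub>c G))\<^sup>2 \<le> opt \<Longrightarrow> X' = ?X"
    if feas: "rbtls_feasible A B X' E G" for X' E G
  proof -
    from feas have X': "X' \<in> carrier_mat n d" and E: "E \<in> carrier_mat m n" and G: "G \<in> carrier_mat m d"
      and eq: "(M + (component_stack E @\<^sub>c component_stack G)) * (X' @\<^sub>r - 1\<^sub>m d) = 0\<^sub>m (4 * m) d"
      by (auto simp: rbtls_feasible_iff[OF A B] M_def)
    have W: "component_stack E @\<^sub>c component_stack G \<in> carrier_mat (4 * m) (n + d)"
      using E G by (intro append_columns_carrier component_stack_carrier)
    note tls = total_least_squares_bound[OF M V gram gap gap' gap'' Zc[OF X'] Lc LZ[OF X'] W eq,
      unfolded frobenius_norm_append_component_stack[OF E G], folded opt_def]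
    show "opt \<le> (frobenius_norm (E @\<^sub>c G))\<^sup>2" by (rule tls(1))
    show "X' = ?X" if "(frobenius_norm (E @\<^sub>c G))\<^sup>2 \<le> opt"
      using tls(2)[OF _ _ that] orthogonal_to_leading_columns_iff[OF Vb assms(20) V(2,3) H X']
      by blast
  qed
  obtain E G where feas: "rbtls_feasible A B ?X E G" and attained: "(frobenius_norm (E @\<^sub>c G))\<^sup>2 = opt"
  proof -
    have zero: "(V\<^sup>T * (?X @\<^sub>r - 1\<^sub>m d)) $$ (i, j) = 0" if "i < n" "j < d" for i j
      using orthogonal_to_leading_columns_iff[OF Vb assms(20) V(2,3) H X] that by blast
    obtain W where W: "W \<in> carrier_mat (4 * m) (n + d)" "(M + W) * (?X @\<^sub>r - 1\<^sub>m d) = 0\<^sub>m (4 * m) d"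
      "(frobenius_norm W)\<^sup>2 = opt"
      unfolding opt_def
      using total_least_squares_attained[OF M V gram Zc[OF X] Lc LZ[OF X] zero] by blast
    obtain W1 W2 where W12: "W1 \<in> carrier_mat (4 * m) n" "W2 \<in> carrier_mat (4 * m) d" "W = W1 @\<^sub>c W2"
      using append_columns_split[OF W(1)] .
    obtain E where E: "E \<in> carrier_mat m n" "component_stack E = W1"
      using component_stack_surj[OF W12(1)] .
    obtain G where G: "G \<in> carrier_mat m d" "component_stack G = W2"
      using component_stack_surj[OF W12(2)] .
    show thesis
    proof (rule that)
      show "rbtls_feasible A B ?X E G"
        unfolding rbtls_feasible_iff[OF A B] using X E G W W12(3) by (simp add: M_def)
      show "(frobenius_norm (E @\<^sub>c G))\<^sup>2 = opt"
        using frobenius_norm_append_component_stack[OF E(1) G(1)] E G W(3) W12(3) by simp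
    qed
  qed
  have sol: "real_rbtls_solution A B ?X"
    unfolding real_rbtls_solution_def
  proof (intro exI conjI allI impI)
    fix X' E' G' assume "rbtls_feasible A B X' E' G'"
    then have "(frobenius_norm (E @\<^sub>c G))\<^sup>2 \<le> (frobenius_norm (E' @\<^sub>c G'))\<^sup>2"
      using bound attained by simp
    then show "frobenius_norm (E @\<^sub>c G) \<le> frobenius_norm (E' @\<^sub>c G')"
      by (rule power2_le_imp_le[OF _ frobenius_norm_nonneg])
  qed (rule feas)
  \<comment> \<open>A further solution costs no more than the pair attaining \<open>opt\<close>, so
    the equality case applies to it.\<close>
  moreover have "X' = ?X" if sol': "real_rbtls_solution A B X'" for X'
  proof -
    obtain E' G' where feas': "rbtls_feasible A B X' E' G'"
      and "frobenius_norm (E' @\<^sub>c G') \<le> frobenius_norm (E @\<^sub>c G)"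
      using sol' feas unfolding real_rbtls_solution_def by blast
    then have "(frobenius_norm (E' @\<^sub>c G'))\<^sup>2 \<le> opt"
      unfolding attained[symmetric] by (intro power_mono frobenius_norm_nonneg)
    then show ?thesis by (rule bound_strict[OF feas'])
  qed
  ultimately show ?thesis by blast
qed

end
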